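(* Let $n\geq 3$ be an odd integer and let $\mathcal{A}_{4n,3}$ denote the collection of subsets of $\mathrm{Dic}_{4n}$ of size $3$. Then, except for $n=3$ (i.e. whenever $n\neq 3$), the collection $\mathcal{A}_{4n,3}$ contains strictly more MSTD sets than MDTS sets.
   Context: For a positive integer $n$, the dicyclic group is $\mathrm{Dic}_{4n}=\langle a,b : a^{2n}=1,\ a^{n}=b^2,\ b^{-1}ab=a^{-1}\rangle$, a group of order $4n$ with elements $1,a,\dots,a^{2n-1},b,ab,\dots,a^{2n-1}b$. For a subset $A$ of a finite (multiplicatively written) group, put $A+A=\{a_1a_2: a_1,a_2\in A\}$ and $A-A=\{a_1a_2^{-1}: a_1,a_2\in A\}$. The set $A$ is MSTD if $|A+A|>|A-A|$ and MDTS if $|A+A|<|A-A|$. *)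

theory Defs
  imports "HOL-Algebra.Coset"
begin

section \<open>Groups given by generators and relations\<close>

text \<open>Words over the generators in \<^typ>\<open>'g\<close>: the letter \<open>(x, True)\<close> stands for \<open>x\<close> and
  \<open>(x, False)\<close> for its formal inverse. A relation \<open>l = r\<close> is a pair of words.\<close>

type_synonym 'g word = "('g \<times> bool) list"

inductive pres_cong :: "('g word \<times> 'g word) set \<Rightarrow> 'g word \<Rightarrow> 'g word \<Rightarrow> bool" for R where
  refl: "pres_cong R u u"
| sym: "pres_cong R u v \<Longrightarrow> pres_cong R v u"
| trans: "pres_cong R u v \<Longrightarrow> pres_cong R v w \<Longrightarrow> pres_cong R u w"
| cancel: "pres_cong R (u @ [(x, s), (x, \<not> s)] @ v) (u @ v)"
| rel: "(l, r) \<in> R \<Longrightarrow> pres_cong R (u @ l @ v) (u @ r @ v)"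

definition pres_class :: "('g word \<times> 'g word) set \<Rightarrow> 'g word \<Rightarrow> 'g word set" where
  "pres_class R w = {v. pres_cong R w v}"

definition presented_group :: "('g word \<times> 'g word) set \<Rightarrow> 'g word set monoid" where
  "presented_group R =
     \<lparr>carrier = range (pres_class R),
      mult = (\<lambda>X Y. \<Union>u\<in>X. \<Union>v\<in>Y. pres_class R (u @ v)),
      one = pres_class R []\<rparr>"

section \<open>The dicyclic group of order \<open>4n\<close>\<close>

datatype dic_gen = GenA | GenB

definition dic_rels :: "nat \<Rightarrow> (dic_gen word \<times> dic_gen word) set" where
  "dic_rels n =
    {(replicate (2 * n) (GenA, True), []),
     (replicate n (GenA, True), [(GenB, True), (GenB, True)]),
     ([(GenB, False), (GenA, True), (GenB, True)], [(GenA, False)])}"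

definition Dic :: "nat \<Rightarrow> dic_gen word set monoid" where
  "Dic n = presented_group (dic_rels n)"

section \<open>MSTD and MDTS sets\<close>

text \<open>The sumset \<open>A + A\<close> of a multiplicatively written group is \<open>A <#> A\<close>, and the difference set
  \<open>A - A\<close> is \<open>A <#> set_inv A\<close>. Cardinalities are meaningful because they are only compared for
  finite \<open>A\<close>.\<close>

definition MSTD :: "('a, 'b) monoid_scheme \<Rightarrow> 'a set \<Rightarrow> bool" where
  "MSTD G A \<longleftrightarrow> card (A <#>\<^bsub>G\<^esub> A) > card (A <#>\<^bsub>G\<^esub> (set_inv\<^bsub>G\<^esub> A))"

definition MDTS :: "('a, 'b) monoid_scheme \<Rightarrow> 'a set \<Rightarrow> bool" where
  "MDTS G A \<longleftrightarrow> card (A <#>\<^bsub>G\<^esub> A) < card (A <#>\<^bsub>G\<^esub> (set_inv\<^bsub>G\<^esub> A))"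

definition subsets_of_size :: "('a, 'b) monoid_scheme \<Rightarrow> nat \<Rightarrow> 'a set set" where
  "subsets_of_size G k = {A. A \<subseteq> carrier G \<and> card A = k}"

section \<open>Well-definedness: \<open>Dic n\<close> is a group of order \<open>4n\<close>\<close>

lemma pres_cong_append:
  assumes "pres_cong R u u'" "pres_cong R v v'"
  shows "pres_cong R (u @ v) (u' @ v')"
proof -
  have L: "pres_cong R (p @ x @ q) (p @ y @ q)" if "pres_cong R x y" for p q x y
    using that
  proof (induction)
    case (cancel x y s z)
    show ?case using pres_cong.cancel[of R "p @ x" y s "z @ q"] by simp
  next
    case (rel l r x y)
    show ?case using pres_cong.rel[OF rel, of "p @ x" "y @ q"] by simp
  next
    case (refl x)
    show ?case by (rule pres_cong.refl)
  next
    case (sym x y)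
    from sym.IH show ?case by (rule pres_cong.sym)
  next
    case (trans x y z)
    from trans.IH show ?case by (rule pres_cong.trans)
  qed
  have "pres_cong R (u @ v) (u' @ v)" using L[OF assms(1), of "[]" v] by simp
  moreover have "pres_cong R (u' @ v) (u' @ v')" using L[OF assms(2), of u' "[]"] by simp
  ultimately show ?thesis by (rule pres_cong.trans)
qed

lemma pres_class_eq_iff: "pres_class R u = pres_class R v \<longleftrightarrow> pres_cong R u v"
proof
  assume "pres_class R u = pres_class R v"
  moreover have "v \<in> pres_class R v" by (simp add: pres_class_def pres_cong.refl)
  ultimately show "pres_cong R u v" by (simp add: pres_class_def set_eq_iff)
next
  assume "pres_cong R u v"
  then have "pres_cong R u w \<longleftrightarrow> pres_cong R v w" for w
    using pres_cong.trans[of R u v w] pres_cong.trans[of R v u w] pres_cong.sym[of R u v] by argo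
  then show "pres_class R u = pres_class R v" by (simp add: pres_class_def)
qed

lemma presented_group_mult:
  "pres_class R u \<otimes>\<^bsub>presented_group R\<^esub> pres_class R v = pres_class R (u @ v)"
proof -
  have "pres_class R (u' @ v') = pres_class R (u @ v)"
    if "u' \<in> pres_class R u" "v' \<in> pres_class R v" for u' v'
  proof -
    have "pres_cong R u u'" "pres_cong R v v'" using that by (simp_all add: pres_class_def)
    then have "pres_cong R (u @ v) (u' @ v')" by (rule pres_cong_append)
    then show ?thesis unfolding pres_class_eq_iff by (rule pres_cong.sym)
  qed
  moreover have "u \<in> pres_class R u" "v \<in> pres_class R v"
    by (simp_all add: pres_class_def pres_cong.refl)
  then have "pres_class R u \<noteq> {}" "pres_class R v \<noteq> {}" by blast+
  ultimately show ?thesis by (simp add: presented_group_def)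
qed

lemma pres_cong_inverse:
  "pres_cong R (rev (map (\<lambda>(x, s). (x, \<not> s)) w) @ w) []"
proof (induction w)
  case (Cons l w)
  obtain x s where l: "l = (x, s)" by fastforce
  have "pres_cong R (rev (map (\<lambda>(x, s). (x, \<not> s)) w) @ [(x, \<not> s), (x, \<not> \<not> s)] @ w)
          (rev (map (\<lambda>(x, s). (x, \<not> s)) w) @ w)"
    by (rule pres_cong.cancel)
  from pres_cong.trans[OF this Cons.IH] show ?case by (simp add: l)
qed (simp add: pres_cong.refl)

lemma group_presented_group: "group (presented_group R)"
proof (rule groupI)
  fix X assume "X \<in> carrier (presented_group R)"
  then obtain w where X: "X = pres_class R w" by (auto simp: presented_group_def)
  let ?Y = "pres_class R (rev (map (\<lambda>(x, s). (x, \<not> s)) w))"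
  have "?Y \<in> carrier (presented_group R)" by (simp add: presented_group_def)
  moreover have "?Y \<otimes>\<^bsub>presented_group R\<^esub> X = \<one>\<^bsub>presented_group R\<^esub>"
    unfolding X presented_group_mult
    by (simp add: presented_group_def pres_class_eq_iff pres_cong_inverse)
  ultimately show "\<exists>Y\<in>carrier (presented_group R). Y \<otimes>\<^bsub>presented_group R\<^esub> X = \<one>\<^bsub>presented_group R\<^esub>"
    by blast
next
  fix X assume "X \<in> carrier (presented_group R)"
  then obtain w where X: "X = pres_class R w" by (auto simp: presented_group_def)
  show "\<one>\<^bsub>presented_group R\<^esub> \<otimes>\<^bsub>presented_group R\<^esub> X = X"
    using presented_group_mult[of R "[]" w] by (simp add: X presented_group_def)
next
  fix X Y Z
  assume "X \<in> carrier (presented_group R)" "Y \<in> carrier (presented_group R)"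
    "Z \<in> carrier (presented_group R)"
  then obtain u v w where "X = pres_class R u" "Y = pres_class R v" "Z = pres_class R w"
    by (auto simp: presented_group_def)
  then show "X \<otimes>\<^bsub>presented_group R\<^esub> Y \<otimes>\<^bsub>presented_group R\<^esub> Z
      = X \<otimes>\<^bsub>presented_group R\<^esub> (Y \<otimes>\<^bsub>presented_group R\<^esub> Z)"
    by (simp add: presented_group_mult)
next
  fix X Y assume "X \<in> carrier (presented_group R)" "Y \<in> carrier (presented_group R)"
  then obtain u v where "X = pres_class R u" "Y = pres_class R v"
    by (auto simp: presented_group_def)
  then have "X \<otimes>\<^bsub>presented_group R\<^esub> Y = pres_class R (u @ v)" by (simp add: presented_group_mult)
  then show "X \<otimes>\<^bsub>presented_group R\<^esub> Y \<in> carrier (presented_group R)"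
    by (simp add: presented_group_def)
qed (simp add: presented_group_def)

text \<open>\<open>dic_word (i, s)\<close> is the normal form \<open>a\<^sup>i\<close> or \<open>a\<^sup>ib\<close>; \<open>dic_step\<close> is right multiplication of
  a normal form by a letter.\<close>

definition dic_word :: "nat \<times> bool \<Rightarrow> dic_gen word" where
  "dic_word p = replicate (fst p) (GenA, True) @ (if snd p then [(GenB, True)] else [])"

fun dic_step :: "nat \<Rightarrow> dic_gen \<times> bool \<Rightarrow> nat \<times> bool \<Rightarrow> nat \<times> bool" where
  "dic_step n (GenA, t) (i, s) = ((if s = t then i + (2 * n - 1) else i + 1) mod (2 * n), s)"
| "dic_step n (GenB, t) (i, s) = ((if s = t then i + n else i) mod (2 * n), \<not> s)"

lemma dic_step_bound: "n > 0 \<Longrightarrow> fst (dic_step n l q) < 2 * n"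
  by (cases "(n, l, q)" rule: dic_step.cases) simp_all

lemma dic_fold_bound: "n > 0 \<Longrightarrow> fst q < 2 * n \<Longrightarrow> fst (fold (dic_step n) w q) < 2 * n"
  by (induction w arbitrary: q) (simp_all add: dic_step_bound)

lemma dic_fold_replicate:
  assumes "n > 0" "i < 2 * n"
  shows "fold (dic_step n) (replicate k (GenA, True)) (i, s)
    = ((i + k * (if s then 2 * n - 1 else 1)) mod (2 * n), s)"
  using assms(2)
proof (induction k arbitrary: i)
  case (Suc k)
  define c where "c = (if s then 2 * n - 1 else 1)"
  have b: "(i + c) mod (2 * n) < 2 * n" using \<open>n > 0\<close> by simp
  have st: "dic_step n (GenA, True) (i, s) = ((i + c) mod (2 * n), s)"
    by (cases s) (simp_all add: c_def)
  have e: "((i + c) mod (2 * n) + k * c) mod (2 * n) = (i + Suc k * c) mod (2 * n)"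
    by (simp add: mod_add_left_eq add.assoc)
  show ?case
    unfolding replicate_Suc fold_simps st Suc.IH[OF b] c_def[symmetric] e ..
qed simp

lemma dic_step_cancel:
  assumes "n > 0" "fst q < 2 * n"
  shows "dic_step n (x, \<not> t) (dic_step n (x, t) q) = q"
proof -
  obtain i s where q: "q = (i, s)" "i < 2 * n" using assms(2) by (cases q) simp
  have "i + (2 * n - 1) + 1 = i + 2 * n" "i + 1 + (2 * n - 1) = i + 2 * n" "i + n + n = i + 2 * n"
    using \<open>n > 0\<close> by simp_all
  moreover have i: "i mod (2 * n) = i" using q(2) by simp
  ultimately have "((i + (2 * n - 1)) mod (2 * n) + 1) mod (2 * n) = i"
    "((i + 1) mod (2 * n) + (2 * n - 1)) mod (2 * n) = i"
    "((i + n) mod (2 * n) + n) mod (2 * n) = i"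
    by (simp_all only: mod_add_left_eq mod_add_self2)
  with i show ?thesis
    by (cases x; cases s; cases t)
      (simp_all only: q(1) dic_step.simps if_True if_False simp_thms)
qed

lemma dic_step_rels:
  assumes "n > 0" "fst q < 2 * n" "(l, r) \<in> dic_rels n"
  shows "fold (dic_step n) l q = fold (dic_step n) r q"
proof -
  obtain i s where q: "q = (i, s)" "i < 2 * n" using assms(2) by (cases q) simp
  consider (1) "l = replicate (2 * n) (GenA, True)" "r = []"
    | (2) "l = replicate n (GenA, True)" "r = [(GenB, True), (GenB, True)]"
    | (3) "l = [(GenB, False), (GenA, True), (GenB, True)]" "r = [(GenA, False)]"
    using assms(3) by (auto simp: dic_rels_def)
  then show ?thesis
  proof cases
    case 1
    have "(i + 2 * n * c) mod (2 * n) = i" for c using q(2) by simp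
    then show ?thesis unfolding 1 q(1) dic_fold_replicate[OF assms(1) q(2)] by simp
  next
    case 2
    have "n * (2 * n - 1) = n + (n - 1) * (2 * n)" using \<open>n > 0\<close>
      by (cases n) (auto simp: algebra_simps)
    then have "(i + n * (2 * n - 1)) mod (2 * n) = (i + n) mod (2 * n)"
      by (simp only: add.assoc[symmetric] mod_mult_self1)
    then show ?thesis using q(2) unfolding 2 q(1) dic_fold_replicate[OF assms(1) q(2)]
      by (cases s) simp_all
  next
    case 3
    show ?thesis
    proof (cases s)
      case True
      have "i + (2 * n - 1) + n = i + n + (2 * n - 1)" by simp
      with True show ?thesis
        using q(2) by (simp add: 3 q(1) mod_simps)
    next
      case False
      have "i + n + (2 * n - 1) + n = i + (2 * n - 1) + 2 * n" by simp
      then have "(((i + n) mod (2 * n) + (2 * n - 1)) mod (2 * n) + n) mod (2 * n)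
          = (i + (2 * n - 1)) mod (2 * n)"
        by (simp only: mod_add_left_eq mod_add_self2)
      with False show ?thesis
        by (simp only: 3 q(1) dic_step.simps fold_simps simp_thms if_True if_False)
    qed
  qed
qed

lemma dic_fold_cong:
  assumes "pres_cong (dic_rels n) u v" "n > 0" "fst p < 2 * n"
  shows "fold (dic_step n) u p = fold (dic_step n) v p"
  using assms(1,3)
proof (induction arbitrary: p)
  case (cancel u x s v)
  then show ?case
    using dic_step_cancel[OF \<open>n > 0\<close> dic_fold_bound[OF \<open>n > 0\<close>]] by simp
next
  case (rel l r u v)
  then show ?case
    using dic_step_rels[OF \<open>n > 0\<close> dic_fold_bound[OF \<open>n > 0\<close>]] by simp
qed simp_all

lemma dic_fold_word: "n > 0 \<Longrightarrow> fst p < 2 * n \<Longrightarrow> fold (dic_step n) (dic_word p) (0, False) = p"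
  by (cases p) (simp add: dic_word_def dic_fold_replicate del: fold_replicate)

abbreviation dic_a :: "nat \<Rightarrow> dic_gen word set" where
  "dic_a n \<equiv> pres_class (dic_rels n) [(GenA, True)]"

abbreviation dic_b :: "nat \<Rightarrow> dic_gen word set" where
  "dic_b n \<equiv> pres_class (dic_rels n) [(GenB, True)]"

lemma group_Dic: "group (Dic n)"
  unfolding Dic_def by (rule group_presented_group)

lemma Dic_mult: "pres_class (dic_rels n) u \<otimes>\<^bsub>Dic n\<^esub> pres_class (dic_rels n) v
    = pres_class (dic_rels n) (u @ v)"
  by (simp add: Dic_def presented_group_mult)

lemma Dic_one: "\<one>\<^bsub>Dic n\<^esub> = pres_class (dic_rels n) []"
  by (simp add: Dic_def presented_group_def)

lemma Dic_carrier: "carrier (Dic n) = range (pres_class (dic_rels n))"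
  by (simp add: Dic_def presented_group_def)

lemma Dic_closed [simp]: "pres_class (dic_rels n) w \<in> carrier (Dic n)"
  by (simp add: Dic_carrier)

lemma Dic_pow: "dic_a n [^]\<^bsub>Dic n\<^esub> (k::nat) = pres_class (dic_rels n) (replicate k (GenA, True))"
proof -
  interpret group "Dic n" by (rule group_Dic)
  show ?thesis
    by (induction k) (simp_all add: Dic_one Dic_mult replicate_append_same)
qed

lemma Dic_inv: "inv\<^bsub>Dic n\<^esub> (pres_class (dic_rels n) [(x, True)]) = pres_class (dic_rels n) [(x, False)]"
proof -
  interpret group "Dic n" by (rule group_Dic)
  have "pres_cong (dic_rels n) [(x, False), (x, True)] []"
    using pres_cong.cancel[of "dic_rels n" "[]" x False "[]"] by simp
  then show ?thesis
    by (intro inv_equality Dic_closed) (simp add: Dic_mult Dic_one pres_class_eq_iff)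
qed

lemma Dic_rel: "(l, r) \<in> dic_rels n \<Longrightarrow> pres_class (dic_rels n) l = pres_class (dic_rels n) r"
  using pres_cong.rel[of l r "dic_rels n" "[]" "[]"] by (simp add: pres_class_eq_iff)

lemma Dic_relations:
  "dic_a n [^]\<^bsub>Dic n\<^esub> (2 * n) = \<one>\<^bsub>Dic n\<^esub>"
  "dic_a n [^]\<^bsub>Dic n\<^esub> n = dic_b n \<otimes>\<^bsub>Dic n\<^esub> dic_b n"
  "inv\<^bsub>Dic n\<^esub> dic_b n \<otimes>\<^bsub>Dic n\<^esub> dic_a n \<otimes>\<^bsub>Dic n\<^esub> dic_b n = inv\<^bsub>Dic n\<^esub> dic_a n"
  unfolding Dic_pow Dic_inv Dic_mult Dic_one by (rule Dic_rel, simp add: dic_rels_def)+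

lemma dic_word_step:
  assumes "n > 0"
  shows "pres_class (dic_rels n) (dic_word p @ [l]) = pres_class (dic_rels n) (dic_word (dic_step n l p))"
proof -
  interpret group "Dic n" by (rule group_Dic)
  define a b where "a = dic_a n" and "b = dic_b n"
  have c [simp]: "a \<in> carrier (Dic n)" "b \<in> carrier (Dic n)"
    by (simp_all add: a_def b_def)
  note r = Dic_relations[of n, folded a_def b_def]
  have word: "pres_class (dic_rels n) (dic_word (i, s))
      = (if s then a [^]\<^bsub>Dic n\<^esub> i \<otimes>\<^bsub>Dic n\<^esub> b else a [^]\<^bsub>Dic n\<^esub> i)" for i s
    by (simp add: dic_word_def a_def b_def Dic_pow Dic_mult)
  have letter: "pres_class (dic_rels n) [l] = (case l of
      (GenA, t) \<Rightarrow> if t then a else inv\<^bsub>Dic n\<^esub> a | (GenB, t) \<Rightarrow> if t then b else inv\<^bsub>Dic n\<^esub> b)"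
    by (auto simp: a_def b_def Dic_inv split: prod.split dic_gen.split)
  have md: "a [^]\<^bsub>Dic n\<^esub> (k mod (2 * n)) = a [^]\<^bsub>Dic n\<^esub> k" for k :: nat
  proof -
    have "a [^]\<^bsub>Dic n\<^esub> (2 * n * (k div (2 * n))) = \<one>\<^bsub>Dic n\<^esub>"
      using nat_pow_pow[OF c(1), of "2 * n" "k div (2 * n)"] r(1) by simp
    then have "a [^]\<^bsub>Dic n\<^esub> (2 * n * (k div (2 * n)) + k mod (2 * n)) = a [^]\<^bsub>Dic n\<^esub> (k mod (2 * n))"
      by (simp only: nat_pow_mult[OF c(1), symmetric] l_one nat_pow_closed[OF c(1)])
    then show ?thesis by simp
  qed
  have ai: "inv\<^bsub>Dic n\<^esub> a = a [^]\<^bsub>Dic n\<^esub> (2 * n - 1)"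
  proof (rule inv_equality)
    have "a [^]\<^bsub>Dic n\<^esub> (2 * n - 1) \<otimes>\<^bsub>Dic n\<^esub> a = a [^]\<^bsub>Dic n\<^esub> Suc (2 * n - 1)" by simp
    then show "a [^]\<^bsub>Dic n\<^esub> (2 * n - 1) \<otimes>\<^bsub>Dic n\<^esub> a = \<one>\<^bsub>Dic n\<^esub>" using r(1) \<open>n > 0\<close> by simp
  qed simp_all
  have ab: "b \<otimes>\<^bsub>Dic n\<^esub> inv\<^bsub>Dic n\<^esub> a = a \<otimes>\<^bsub>Dic n\<^esub> b"
    unfolding r(3)[symmetric] by (simp add: m_assoc inv_solve_left' flip: m_assoc)
  have ba: "b \<otimes>\<^bsub>Dic n\<^esub> a = inv\<^bsub>Dic n\<^esub> a \<otimes>\<^bsub>Dic n\<^esub> b"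
  proof -
    have "a \<otimes>\<^bsub>Dic n\<^esub> (b \<otimes>\<^bsub>Dic n\<^esub> a) = b"
      unfolding m_assoc[OF c(1) c(2) c(1), symmetric] ab[symmetric] by (simp add: m_assoc)
    then show ?thesis by (simp add: inv_solve_left)
  qed
  have bi: "inv\<^bsub>Dic n\<^esub> b = a [^]\<^bsub>Dic n\<^esub> n \<otimes>\<^bsub>Dic n\<^esub> b"
  proof (rule inv_equality)
    have "a [^]\<^bsub>Dic n\<^esub> n \<otimes>\<^bsub>Dic n\<^esub> b \<otimes>\<^bsub>Dic n\<^esub> b = a [^]\<^bsub>Dic n\<^esub> n \<otimes>\<^bsub>Dic n\<^esub> a [^]\<^bsub>Dic n\<^esub> n"
      by (simp only: m_assoc c nat_pow_closed flip: r(2))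
    also have "\<dots> = \<one>\<^bsub>Dic n\<^esub>" by (simp only: nat_pow_mult c r(1) flip: mult_2)
    finally show "a [^]\<^bsub>Dic n\<^esub> n \<otimes>\<^bsub>Dic n\<^esub> b \<otimes>\<^bsub>Dic n\<^esub> b = \<one>\<^bsub>Dic n\<^esub>" .
  qed simp_all
  obtain i s x t where p: "p = (i, s)" "l = (x, t)" by fastforce
  have *: "pres_class (dic_rels n) (dic_word p @ [l])
    = pres_class (dic_rels n) (dic_word p) \<otimes>\<^bsub>Dic n\<^esub> pres_class (dic_rels n) [l]"
    by (simp add: Dic_mult)
  have shift: "a [^]\<^bsub>Dic n\<^esub> i \<otimes>\<^bsub>Dic n\<^esub> (a [^]\<^bsub>Dic n\<^esub> j \<otimes>\<^bsub>Dic n\<^esub> b)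
      = a [^]\<^bsub>Dic n\<^esub> (i + j) \<otimes>\<^bsub>Dic n\<^esub> b" for j
    by (simp only: m_assoc[symmetric] nat_pow_mult c nat_pow_closed)
  have AFT: "a [^]\<^bsub>Dic n\<^esub> i \<otimes>\<^bsub>Dic n\<^esub> a = a [^]\<^bsub>Dic n\<^esub> (i + 1)" by simp
  have AFF: "a [^]\<^bsub>Dic n\<^esub> i \<otimes>\<^bsub>Dic n\<^esub> inv\<^bsub>Dic n\<^esub> a = a [^]\<^bsub>Dic n\<^esub> (i + (2 * n - 1))"
    by (simp only: ai nat_pow_mult c)
  have ATT: "a [^]\<^bsub>Dic n\<^esub> i \<otimes>\<^bsub>Dic n\<^esub> b \<otimes>\<^bsub>Dic n\<^esub> a = a [^]\<^bsub>Dic n\<^esub> (i + (2 * n - 1)) \<otimes>\<^bsub>Dic n\<^esub> b"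
    by (simp only: m_assoc ba ai shift c nat_pow_closed)
  have ATF: "a [^]\<^bsub>Dic n\<^esub> i \<otimes>\<^bsub>Dic n\<^esub> b \<otimes>\<^bsub>Dic n\<^esub> inv\<^bsub>Dic n\<^esub> a = a [^]\<^bsub>Dic n\<^esub> (i + 1) \<otimes>\<^bsub>Dic n\<^esub> b"
    by (simp add: m_assoc ab)
  have BFF: "a [^]\<^bsub>Dic n\<^esub> i \<otimes>\<^bsub>Dic n\<^esub> inv\<^bsub>Dic n\<^esub> b = a [^]\<^bsub>Dic n\<^esub> (i + n) \<otimes>\<^bsub>Dic n\<^esub> b"
    by (simp only: bi shift)
  have BTT: "a [^]\<^bsub>Dic n\<^esub> i \<otimes>\<^bsub>Dic n\<^esub> b \<otimes>\<^bsub>Dic n\<^esub> b = a [^]\<^bsub>Dic n\<^esub> (i + n)"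
    by (simp only: m_assoc c nat_pow_closed r(2)[symmetric] nat_pow_mult)
  have BTF: "a [^]\<^bsub>Dic n\<^esub> i \<otimes>\<^bsub>Dic n\<^esub> b \<otimes>\<^bsub>Dic n\<^esub> inv\<^bsub>Dic n\<^esub> b = a [^]\<^bsub>Dic n\<^esub> i"
    by (simp add: m_assoc)
  show ?thesis unfolding * letter unfolding p
    by (cases x; cases s; cases t)
      (simp_all only: dic_step.simps word md AFT AFF ATT ATF BFF BTT BTF
        dic_gen.case prod.case if_True if_False simp_thms)
qed

lemma Dic_normal_form:
  assumes "n > 0"
  shows "bij_betw (\<lambda>p. pres_class (dic_rels n) (dic_word p)) ({..<2 * n} \<times> UNIV) (carrier (Dic n))"
proof (rule bij_betwI')
  fix p q :: "nat \<times> bool"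
  assume "p \<in> {..<2 * n} \<times> UNIV" "q \<in> {..<2 * n} \<times> UNIV"
  then have "fst p < 2 * n" "fst q < 2 * n" by auto
  then have "p = q" if "pres_cong (dic_rels n) (dic_word p) (dic_word q)"
    using dic_fold_cong[OF that assms, of "(0, False)"] assms by (simp add: dic_fold_word)
  then show "(pres_class (dic_rels n) (dic_word p) = pres_class (dic_rels n) (dic_word q)) = (p = q)"
    unfolding pres_class_eq_iff
    using pres_cong.refl[of "dic_rels n" "dic_word p"] by auto
next
  fix X assume "X \<in> carrier (Dic n)"
  then obtain w where X: "X = pres_class (dic_rels n) w" by (auto simp: Dic_carrier)
  have "pres_class (dic_rels n) w = pres_class (dic_rels n) (dic_word (fold (dic_step n) w (0, False)))"
  proof (induction w rule: rev_induct)
    case Nil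
    show ?case by (simp add: dic_word_def)
  next
    case (snoc l w)
    have "pres_class (dic_rels n) (w @ [l])
        = pres_class (dic_rels n) (dic_word (fold (dic_step n) w (0, False)) @ [l])"
      by (simp only: Dic_mult[symmetric] snoc.IH[symmetric])
    then show ?case by (simp add: dic_word_step[OF assms])
  qed
  moreover have "fold (dic_step n) w (0, False) \<in> {..<2 * n} \<times> UNIV"
    using dic_fold_bound[of n "(0, False)" w] assms by (simp add: mem_Times_iff)
  ultimately show "\<exists>p\<in>{..<2 * n} \<times> UNIV. X = pres_class (dic_rels n) (dic_word p)"
    unfolding X by (rule bexI)
qed simp

lemma order_Dic: "n > 0 \<Longrightarrow> order (Dic n) = 4 * n"
  using bij_betw_same_card[OF Dic_normal_form, of n] by (simp add: order_def card_cartesian_product)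

end

theory Submission
  imports Defs
begin

text \<open>The proof rests on an asymmetry between rotations \<open>a\<^sup>i\<close> and flips \<open>a\<^sup>ib\<close>. A three-element
  set with elements of both kinds is usually MSTD. A set of three rotations lies in a cyclic
  group and is usually MDTS, with six sums and seven differences. A set of three flips is always
  balanced. Mixed sets outnumber sets of rotations by about six to one.

  In detail, let exponents be taken modulo \<open>2n\<close>, and let \<open>A\<close> consist of \<open>a\<^sup>i, a\<^sup>j\<close> and the flip
  \<open>a\<^sup>kb\<close>. The rotations in \<open>A - A\<close> have exponents \<open>0, i - j, j - i\<close>; those in \<open>A + A\<close> are the
  translates \<open>i + j, 2i, 2j\<close> of these together with \<open>n\<close>, which is the exponent of the square of
  the flip. The flips in \<open>A - A\<close> have exponents \<open>k + {i, j, i + n, j + n}\<close>, those in \<open>A + A\<close>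
  have exponents \<open>k + {i, j, -i, -j}\<close>. So unless there are coincidences \<open>A + A\<close> has one element
  more than \<open>A - A\<close>. The set fails to be MSTD only when \<open>i\<close> or \<open>j\<close> is \<open>0\<close> or \<open>n\<close>, or \<open>i + j\<close> is
  \<open>0\<close> or \<open>n\<close> (\<open>two_rots_MSTD\<close>), and can be MDTS only when \<open>i + j = 0\<close> (\<open>two_rots_not_MDTS\<close>).
  Oddness of \<open>n\<close> keeps \<open>2i\<close> and \<open>2j\<close> away from \<open>n\<close>. One rotation \<open>a\<^sup>k\<close> and two flips
  \<open>a\<^sup>ib, a\<^sup>jb\<close> behave in the same way: the set is MSTD unless \<open>2k\<close> is \<open>0\<close>, \<open>\<plusminus> (i - j)\<close> or
  \<open>n \<plusminus> (i - j)\<close> (\<open>two_flips_MSTD\<close>), and can be MDTS only when \<open>2k = 0\<close> (\<open>two_flips_not_MDTS\<close>).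

  The exceptions form a lower-dimensional family in each case. Of the \<open>n (2n - 1)\<close> pairs of
  exponents at most \<open>7n - 1\<close> are bad for two rotations, and at most \<open>4n\<close> for two flips and a
  given \<open>k\<close> with \<open>2k \<noteq> 0\<close>. Even if all sets of three rotations are conceded to be MDTS, six
  times the surplus of MSTD sets is at least \<open>4n (10n (n - 5) - n + 23)\<close>, which is positive for
  every \<open>n \<ge> 5\<close>.\<close>

section \<open>Arithmetic in the dicyclic group\<close>

locale dicyclic =
  fixes n :: nat
  assumes n_pos: "n > 0"
begin

sublocale group "Dic n"
  by (rule group_Dic)

abbreviation a :: "dic_gen word set" where "a \<equiv> dic_a n"

abbreviation b :: "dic_gen word set" where "b \<equiv> dic_b n"

text \<open>Every element is \<open>a\<^sup>i\<close> or \<open>a\<^sup>ib\<close>. The exponent is an arbitrary integer, so that products and inverses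
  have formulas free of reductions modulo \<open>2n\<close>.\<close>

definition rot :: "int \<Rightarrow> dic_gen word set" where
  "rot i = a [^]\<^bsub>Dic n\<^esub> i"

definition flip :: "int \<Rightarrow> dic_gen word set" where
  "flip i = rot i \<otimes>\<^bsub>Dic n\<^esub> b"

lemma rot_closed [simp]: "rot i \<in> carrier (Dic n)"
  by (simp add: rot_def)

lemma flip_closed [simp]: "flip i \<in> carrier (Dic n)"
  by (simp add: flip_def)

lemma rot_mult_rot: "rot i \<otimes>\<^bsub>Dic n\<^esub> rot j = rot (i + j)"
  by (simp add: rot_def int_pow_mult)

lemma inv_rot: "inv\<^bsub>Dic n\<^esub> (rot i) = rot (- i)"
  by (simp add: rot_def int_pow_neg)

lemma rot_mult_flip: "rot i \<otimes>\<^bsub>Dic n\<^esub> flip j = flip (i + j)"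
  by (simp add: flip_def rot_mult_rot flip: m_assoc)

text \<open>The third relation says that conjugation by \<open>b\<close> inverts the generator \<open>a\<close>; conjugation
  being a homomorphism, it inverts every power of \<open>a\<close>.\<close>

lemma b_mult_rot: "b \<otimes>\<^bsub>Dic n\<^esub> rot i = flip (- i)"
proof -
  let ?conj = "\<lambda>x. inv\<^bsub>Dic n\<^esub> b \<otimes>\<^bsub>Dic n\<^esub> x \<otimes>\<^bsub>Dic n\<^esub> b"
  have cancel: "b \<otimes>\<^bsub>Dic n\<^esub> (inv\<^bsub>Dic n\<^esub> b \<otimes>\<^bsub>Dic n\<^esub> x) = x" if "x \<in> carrier (Dic n)" for x
    using that by (simp flip: m_assoc)
  have "?conj \<in> hom (Dic n) (Dic n)"
    using cancel by (intro homI) (simp_all add: m_assoc)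
  then have "?conj (rot (- i)) = ?conj a [^]\<^bsub>Dic n\<^esub> (- i)"
    unfolding rot_def by (rule hom_int_pow) (auto intro: group_Dic)
  also have "\<dots> = rot i"
    by (simp add: Dic_relations(3) rot_def int_pow_inv int_pow_neg)
  finally have "b \<otimes>\<^bsub>Dic n\<^esub> rot i = b \<otimes>\<^bsub>Dic n\<^esub> ?conj (rot (- i))" by simp
  also have "\<dots> = flip (- i)"
    by (simp add: flip_def flip: m_assoc)
  finally show ?thesis .
qed

lemma flip_mult_rot: "flip i \<otimes>\<^bsub>Dic n\<^esub> rot j = flip (i - j)"
proof -
  have "flip i \<otimes>\<^bsub>Dic n\<^esub> rot j = rot i \<otimes>\<^bsub>Dic n\<^esub> (b \<otimes>\<^bsub>Dic n\<^esub> rot j)"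
    by (simp add: flip_def m_assoc)
  then show ?thesis by (simp add: b_mult_rot rot_mult_flip)
qed

lemma flip_mult_flip: "flip i \<otimes>\<^bsub>Dic n\<^esub> flip j = rot (i - j + int n)"
proof -
  have "flip i \<otimes>\<^bsub>Dic n\<^esub> flip j = flip i \<otimes>\<^bsub>Dic n\<^esub> rot j \<otimes>\<^bsub>Dic n\<^esub> b"
    by (simp add: flip_def m_assoc)
  also have "\<dots> = rot (i - j) \<otimes>\<^bsub>Dic n\<^esub> (b \<otimes>\<^bsub>Dic n\<^esub> b)"
    by (simp add: flip_mult_rot) (simp add: flip_def m_assoc)
  also have "b \<otimes>\<^bsub>Dic n\<^esub> b = rot (int n)"
    by (simp only: rot_def int_pow_int Dic_relations(2))
  finally show ?thesis by (simp add: rot_mult_rot)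
qed

lemma rot_period: "rot (2 * int n * k) = \<one>\<^bsub>Dic n\<^esub>"
proof -
  have "rot (2 * int n * k) = (a [^]\<^bsub>Dic n\<^esub> (2 * int n)) [^]\<^bsub>Dic n\<^esub> k"
    by (simp add: rot_def int_pow_pow)
  also have "a [^]\<^bsub>Dic n\<^esub> (2 * int n) = \<one>\<^bsub>Dic n\<^esub>"
    using Dic_relations(1)[of n] int_pow_int[of "Dic n" a "2 * n"] by simp
  finally show ?thesis by simp
qed

lemma rot_mod: "rot (i mod (2 * int n)) = rot i"
proof -
  have "rot i = rot (2 * int n * (i div (2 * int n))) \<otimes>\<^bsub>Dic n\<^esub> rot (i mod (2 * int n))"
    unfolding rot_mult_rot by simp
  then show ?thesis by (simp add: rot_period)
qed

lemma flip_mod: "flip (i mod (2 * int n)) = flip i"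
  by (simp add: flip_def rot_mod)

lemma inv_flip: "inv\<^bsub>Dic n\<^esub> (flip i) = flip (i + int n)"
proof (rule inv_equality)
  show "flip (i + int n) \<otimes>\<^bsub>Dic n\<^esub> flip i = \<one>\<^bsub>Dic n\<^esub>"
    using rot_period[of 1] by (simp add: flip_mult_flip)
qed simp_all

lemma rot_normal_form: "rot i = pres_class (dic_rels n) (dic_word (nat (i mod (2 * int n)), False))"
proof -
  have "rot i = a [^]\<^bsub>Dic n\<^esub> nat (i mod (2 * int n))"
    using n_pos rot_mod[of i] by (simp add: rot_def)
  then show ?thesis by (simp add: Dic_pow dic_word_def)
qed

lemma flip_normal_form: "flip i = pres_class (dic_rels n) (dic_word (nat (i mod (2 * int n)), True))"
  by (simp add: flip_def rot_normal_form Dic_mult dic_word_def)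

lemma nat_mod_bound: "nat (i mod (2 * int n)) < 2 * n"
  using n_pos by (simp add: nat_less_iff)

lemmas normal_form_inj = inj_onD[OF bij_betw_imp_inj_on[OF Dic_normal_form[OF n_pos]]]

lemma rot_eq_iff: "rot i = rot j \<longleftrightarrow> i mod (2 * int n) = j mod (2 * int n)"
  using normal_form_inj[of "(nat (i mod (2 * int n)), False)" "(nat (j mod (2 * int n)), False)"]
    nat_mod_bound n_pos
  by (auto simp: rot_normal_form eq_nat_nat_iff)

lemma flip_eq_iff: "flip i = flip j \<longleftrightarrow> i mod (2 * int n) = j mod (2 * int n)"
  by (simp add: flip_def rot_eq_iff)

lemma rot_neq_flip: "rot i \<noteq> flip j"
  using normal_form_inj[of "(nat (i mod (2 * int n)), False)" "(nat (j mod (2 * int n)), True)"]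
    nat_mod_bound by (auto simp: rot_normal_form flip_normal_form)

text \<open>One representative for each residue class of exponents modulo \<open>2n\<close>.\<close>

abbreviation exps :: "int set" where "exps \<equiv> {0..<2 * int n}"

lemma card_exps: "card exps = 2 * n"
  by simp

lemma Dic_carrier_eq: "carrier (Dic n) = rot ` exps \<union> flip ` exps"
proof
  show "carrier (Dic n) \<subseteq> rot ` exps \<union> flip ` exps"
  proof
    fix x assume "x \<in> carrier (Dic n)"
    then obtain i s where x: "x = pres_class (dic_rels n) (dic_word (i, s))" "i < 2 * n"
      unfolding bij_betw_imp_surj_on[OF Dic_normal_form[OF n_pos], symmetric] by auto
    then have "x = (if s then flip (int i) else rot (int i))"
      by (simp add: rot_normal_form flip_normal_form nat_int_comparison)
    with \<open>i < 2 * n\<close> show "x \<in> rot ` exps \<union> flip ` exps" by (auto split: if_splits)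
  qed
qed auto

section \<open>Subsets of the dicyclic group as pairs of exponent sets\<close>

definition dic_set :: "int set \<Rightarrow> int set \<Rightarrow> dic_gen word set set" where
  "dic_set I J = rot ` I \<union> flip ` J"

lemma dic_set_mult:
  "dic_set I J <#>\<^bsub>Dic n\<^esub> dic_set K L =
    dic_set ((\<Union>i\<in>I. \<Union>k\<in>K. {i + k}) \<union> (\<Union>j\<in>J. \<Union>l\<in>L. {j - l + int n}))
            ((\<Union>i\<in>I. \<Union>l\<in>L. {i + l}) \<union> (\<Union>j\<in>J. \<Union>k\<in>K. {j - k}))"
  by (auto simp: dic_set_def set_mult_def image_Un image_UN
      rot_mult_rot rot_mult_flip flip_mult_rot flip_mult_flip)

text \<open>A flip has order four: since \<open>(a\<^sup>jb)\<^sup>2 = a\<^sup>n\<close>, inversion shifts the exponent of a flip by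
  \<open>n\<close>, whereas it negates the exponent of a rotation.\<close>

lemma set_inv_dic_set:
  "set_inv\<^bsub>Dic n\<^esub> (dic_set I J) = dic_set (uminus ` I) ((\<lambda>j. j + int n) ` J)"
  by (auto simp: dic_set_def SET_INV_def inv_rot inv_flip)

lemma dic_set_quotient:
  "dic_set I J <#>\<^bsub>Dic n\<^esub> set_inv\<^bsub>Dic n\<^esub> (dic_set I J) =
    dic_set ((\<Union>i\<in>I. \<Union>k\<in>I. {i - k}) \<union> (\<Union>j\<in>J. \<Union>l\<in>J. {j - l}))
            ((\<Union>i\<in>I. \<Union>j\<in>J. {i + j + int n}) \<union> (\<Union>j\<in>J. \<Union>i\<in>I. {j + i}))"
  by (simp add: set_inv_dic_set dic_set_mult add.assoc diff_add_eq)

text \<open>The cardinality of a set of rotations, or of a set of flips, is the number of residue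
  classes that its exponents occupy. This turns sumset sizes into counting residues modulo \<open>2n\<close>.\<close>

definition rcard :: "int set \<Rightarrow> nat" where
  "rcard X = card ((\<lambda>x. x mod (2 * int n)) ` X)"

lemma card_rot_image: "card (rot ` X) = rcard X"
proof -
  have "rot ` X = rot ` (\<lambda>x. x mod (2 * int n)) ` X"
    by (simp add: image_image rot_mod)
  moreover have "inj_on rot ((\<lambda>x. x mod (2 * int n)) ` X)"
    by (auto simp: inj_on_def rot_eq_iff)
  ultimately show ?thesis by (simp add: rcard_def card_image)
qed

lemma card_flip_image: "card (flip ` X) = rcard X"
proof -
  have "flip ` X = flip ` (\<lambda>x. x mod (2 * int n)) ` X"
    by (simp add: image_image flip_mod)
  moreover have "inj_on flip ((\<lambda>x. x mod (2 * int n)) ` X)"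
    by (auto simp: inj_on_def flip_eq_iff)
  ultimately show ?thesis by (simp add: rcard_def card_image)
qed

lemma card_dic_set: "finite I \<Longrightarrow> finite J \<Longrightarrow> card (dic_set I J) = rcard I + rcard J"
  unfolding dic_set_def
  by (subst card_Un_disjoint) (auto simp: rot_neq_flip card_rot_image card_flip_image)

lemma card_dic_set_exps:
  assumes "I \<subseteq> exps" "J \<subseteq> exps"
  shows "card (dic_set I J) = card I + card J"
proof -
  have "(\<lambda>x. x mod (2 * int n)) ` X = id ` X" if "X \<subseteq> exps" for X
    using that by (intro image_cong) auto
  with assms show ?thesis
    by (simp add: card_dic_set rcard_def finite_subset[of _ exps])
qed

lemma dic_set_subset: "dic_set I J \<subseteq> carrier (Dic n)"
  by (auto simp: dic_set_def)

lemma rot_in_dic_set_iff: "rot i \<in> dic_set I J \<longleftrightarrow> i \<in> I" if "i \<in> exps" "I \<subseteq> exps"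
  using that by (force simp: dic_set_def rot_eq_iff rot_neq_flip)

lemma flip_in_dic_set_iff: "flip i \<in> dic_set I J \<longleftrightarrow> i \<in> J" if "i \<in> exps" "J \<subseteq> exps"
  using that rot_neq_flip[symmetric] by (force simp: dic_set_def flip_eq_iff)

lemma inj_on_dic_set: "inj_on (\<lambda>(I, J). dic_set I J) (Pow exps \<times> Pow exps)"
proof (rule inj_onI, clarify, intro conjI)
  fix I J I' J' assume *: "I \<subseteq> exps" "J \<subseteq> exps" "I' \<subseteq> exps" "J' \<subseteq> exps"
    and eq: "dic_set I J = dic_set I' J'"
  show "I = I'" using * eq rot_in_dic_set_iff by blast
  show "J = J'" using * eq flip_in_dic_set_iff by blast
qed

lemma dic_set_cases:
  assumes "A \<subseteq> carrier (Dic n)"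
  obtains I J where "I \<subseteq> exps" "J \<subseteq> exps" "A = dic_set I J"
proof
  show "A = dic_set {i \<in> exps. rot i \<in> A} {j \<in> exps. flip j \<in> A}"
    using assms by (auto simp: dic_set_def Dic_carrier_eq)
qed auto

lemma rcard_insert:
  "finite X \<Longrightarrow> rcard (insert x X)
    = (if \<exists>y\<in>X. 2 * int n dvd x - y then rcard X else Suc (rcard X))"
  by (auto simp: rcard_def card_insert_if image_iff mod_eq_dvd_iff)

lemma rcard_translate: "rcard ((+) t ` X) = rcard X"
proof -
  have "rot ` (+) t ` X = (\<otimes>\<^bsub>Dic n\<^esub>) (rot t) ` rot ` X"
    by (simp add: image_image rot_mult_rot)
  moreover have "inj_on ((\<otimes>\<^bsub>Dic n\<^esub>) (rot t)) (rot ` X)"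
    by (auto intro!: inj_onI)
  ultimately show ?thesis by (simp add: card_image flip: card_rot_image)
qed

lemma rcard_le_card: "finite X \<Longrightarrow> rcard X \<le> card X"
  unfolding rcard_def by (rule card_image_le)

lemma rcard_mono: "finite Y \<Longrightarrow> X \<subseteq> Y \<Longrightarrow> rcard X \<le> rcard Y"
  unfolding rcard_def by (intro card_mono) auto

end

section \<open>Sumsets and difference sets of three-element subsets\<close>

locale odd_dicyclic = dicyclic +
  assumes odd_n: "odd n"
begin

text \<open>In group terms: the common square \<open>a\<^sup>n\<close> of all flips is not the square of a rotation.\<close>

lemma double_not_cong_n: "\<not> 2 * int n dvd 2 * x - int n" "\<not> 2 * int n dvd int n - 2 * x"
proof -
  have "odd (2 * x - int n)" "odd (int n - 2 * x)" using odd_n by simp_all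
  then show "\<not> 2 * int n dvd 2 * x - int n" "\<not> 2 * int n dvd int n - 2 * x"
    using dvd_mult_left by blast+
qed

text \<open>In a set of two rotations and a flip, the sums of rotations \<open>{2i, i + j, 2j}\<close> are a
  translate of the differences \<open>{0, i - j, j - i}\<close>. So the rotations of \<open>A + A\<close> are as many as
  those of \<open>A - A\<close>, and one more if the square \<open>a\<^sup>n\<close> of the flip is new; by parity it can only
  coincide with \<open>a\<^sup>i\<^sup>+\<^sup>j\<close>. The flips are translates of a set that does not depend on \<open>k\<close>. This
  treats \<open>i - j = n\<close>, where the differences degenerate, on the same footing as the generic case.\<close>

lemma two_rots_card_product:
  "card (dic_set {i, j} {k} <#>\<^bsub>Dic n\<^esub> dic_set {i, j} {k}) =
    rcard {0, i - j, j - i} + (if 2 * int n dvd i + j - int n then 0 else 1) + rcard {i, j, - i, - j}"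
proof -
  have "{i + i, i + j, j + i, j + j} = (+) (i + j) ` {0, i - j, j - i}" by auto
  then have sums: "rcard {i + i, i + j, j + i, j + j} = rcard {0, i - j, j - i}"
    by (simp only: rcard_translate)
  have "rcard (insert (int n) {i + i, i + j, j + i, j + j})
      = rcard {i + i, i + j, j + i, j + j} + (if 2 * int n dvd i + j - int n then 0 else 1)"
    using double_not_cong_n[of i] double_not_cong_n[of j]
    by (subst rcard_insert) (simp_all add: add.commute[of j i] dvd_diff_commute[of _ "int n"])
  moreover have "{i + k, j + k, k - i, k - j} = (+) k ` {i, j, - i, - j}" by auto
  then have "rcard {i + k, j + k, k - i, k - j} = rcard {i, j, - i, - j}"
    by (simp only: rcard_translate)
  moreover have "dic_set {i, j} {k} <#>\<^bsub>Dic n\<^esub> dic_set {i, j} {k} =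
      dic_set (insert (int n) {i + i, i + j, j + i, j + j}) {i + k, j + k, k - i, k - j}"
    unfolding dic_set_mult by (rule arg_cong2[of _ _ _ _ dic_set]) auto
  ultimately show ?thesis by (simp only: card_dic_set sums finite.intros)
qed

lemma two_rots_card_quotient:
  "card (dic_set {i, j} {k} <#>\<^bsub>Dic n\<^esub> set_inv\<^bsub>Dic n\<^esub> (dic_set {i, j} {k})) =
    rcard {0, i - j, j - i} + rcard {i, j, i + int n, j + int n}"
proof -
  have "{i + k, j + k, i + k + int n, j + k + int n} = (+) k ` {i, j, i + int n, j + int n}" by auto
  then have "rcard {i + k, j + k, i + k + int n, j + k + int n} = rcard {i, j, i + int n, j + int n}"
    by (simp only: rcard_translate)
  moreover have "dic_set {i, j} {k} <#>\<^bsub>Dic n\<^esub> set_inv\<^bsub>Dic n\<^esub> (dic_set {i, j} {k}) =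
      dic_set {0, i - j, j - i} {i + k, j + k, i + k + int n, j + k + int n}"
    unfolding dic_set_quotient by (rule arg_cong2[of _ _ _ _ dic_set]) auto
  ultimately show ?thesis by (simp only: card_dic_set finite.intros)
qed

text \<open>With one rotation and two flips the roles are exchanged: the flips contribute to the
  rotations of \<open>A + A\<close> the translate by \<open>n\<close> of the differences, and the extra element is the
  square \<open>a\<^sup>2\<^sup>k\<close> of the rotation.\<close>

lemma two_flips_card_product:
  "card (dic_set {k} {i, j} <#>\<^bsub>Dic n\<^esub> dic_set {k} {i, j}) =
    rcard {0, i - j, j - i}
    + (if 2 * int n dvd 2 * k - (i - j) - int n \<or> 2 * int n dvd 2 * k - (j - i) - int n then 0 else 1)
    + rcard {k + i, k + j, i - k, j - k}"
proof -
  have "{i - i + int n, i - j + int n, j - i + int n, j - j + int n}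
      = (+) (int n) ` {0, i - j, j - i}" by auto
  then have sums: "rcard {i - i + int n, i - j + int n, j - i + int n, j - j + int n}
      = rcard {0, i - j, j - i}"
    by (simp only: rcard_translate)
  have "rcard (insert (k + k) {i - i + int n, i - j + int n, j - i + int n, j - j + int n})
      = rcard {i - i + int n, i - j + int n, j - i + int n, j - j + int n}
        + (if 2 * int n dvd 2 * k - (i - j) - int n \<or> 2 * int n dvd 2 * k - (j - i) - int n then 0 else 1)"
    using double_not_cong_n[of k]
    by (subst rcard_insert) (simp_all add: algebra_simps)
  moreover have "dic_set {k} {i, j} <#>\<^bsub>Dic n\<^esub> dic_set {k} {i, j} =
      dic_set (insert (k + k) {i - i + int n, i - j + int n, j - i + int n, j - j + int n})
        {k + i, k + j, i - k, j - k}"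
    unfolding dic_set_mult by (rule arg_cong2[of _ _ _ _ dic_set]) auto
  ultimately show ?thesis by (simp only: card_dic_set sums finite.intros)
qed

lemma two_flips_card_quotient:
  "card (dic_set {k} {i, j} <#>\<^bsub>Dic n\<^esub> set_inv\<^bsub>Dic n\<^esub> (dic_set {k} {i, j})) =
    rcard {0, i - j, j - i} + rcard {i, j, i + int n, j + int n}"
proof -
  have "{i + k, j + k, i + k + int n, j + k + int n} = (+) k ` {i, j, i + int n, j + int n}" by auto
  then have "rcard {i + k, j + k, i + k + int n, j + k + int n} = rcard {i, j, i + int n, j + int n}"
    by (simp only: rcard_translate)
  moreover have "dic_set {k} {i, j} <#>\<^bsub>Dic n\<^esub> set_inv\<^bsub>Dic n\<^esub> (dic_set {k} {i, j}) =
      dic_set {0, i - j, j - i} {i + k, j + k, i + k + int n, j + k + int n}"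
    unfolding dic_set_quotient by (rule arg_cong2[of _ _ _ _ dic_set]) auto
  ultimately show ?thesis by (simp only: card_dic_set finite.intros)
qed

lemma rcard_quotient_flips_le: "rcard {i, j, i + int n, j + int n} \<le> 4"
  by (rule order.trans[OF rcard_le_card]) (auto intro!: order.trans[OF card_insert_le_m1])

lemma rcard_empty: "rcard {} = 0"
  by (simp add: rcard_def)

lemma n_dvd_halve: "2 * int n dvd x + x \<longleftrightarrow> int n dvd x"
  by (simp flip: mult_2)

text \<open>Up to translation the flips in \<open>A + A\<close> have exponents \<open>i, j, -i, -j\<close>. If \<open>i \<noteq> j\<close>, two of
  them can only coincide through \<open>i + j = 0\<close>, \<open>2i = 0\<close> or \<open>2j = 0\<close>.\<close>

lemma two_rots_flips:
  assumes "\<not> 2 * int n dvd i - j" "\<not> 2 * int n dvd i + j" "\<not> int n dvd i"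
  shows "rcard {i, j, - i, - j} \<ge> 3" and "\<not> int n dvd j \<Longrightarrow> rcard {i, j, - i, - j} = 4"
proof -
  have "- j - i = - (i + j)" "- i - j = - (i + j)" by simp_all
  then have *: "\<not> 2 * int n dvd j - i" "\<not> 2 * int n dvd - j - i" "\<not> 2 * int n dvd - i - j"
    using assms(1,2) by (simp_all only: dvd_minus_iff dvd_diff_commute[of _ j] not_False_eq_True)
  have "3 = rcard {i, j, - i}"
    using assms * by (simp add: rcard_insert rcard_empty n_dvd_halve add.commute)
  also have "rcard {i, j, - i} \<le> rcard {i, j, - i, - j}"
    by (rule rcard_mono) auto
  finally show "rcard {i, j, - i, - j} \<ge> 3" .
  show "rcard {i, j, - i, - j} = 4" if "\<not> int n dvd j"
    using assms * that by (simp add: rcard_insert rcard_empty n_dvd_halve add.commute)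
qed

lemma two_rots_MSTD:
  assumes "\<not> 2 * int n dvd i - j" "\<not> int n dvd i" "\<not> int n dvd j"
    "\<not> 2 * int n dvd i + j" "\<not> 2 * int n dvd i + j - int n"
  shows "MSTD (Dic n) (dic_set {i, j} {k})"
  unfolding MSTD_def two_rots_card_product two_rots_card_quotient
  using two_rots_flips(2)[of i j] rcard_quotient_flips_le[of i j] assms by simp

text \<open>If \<open>i + j = n\<close> the extra rotation of \<open>A + A\<close> is lost, but then \<open>-i = j + n\<close> and
  \<open>-j = i + n\<close>, so \<open>A + A\<close> and \<open>A - A\<close> have equally many flips. Otherwise the extra rotation
  makes up for the loss of at most one flip; not both of \<open>i\<close>, \<open>j\<close> lie in \<open>{0, n}\<close>, because
  \<open>0 + n = n\<close>.\<close>

lemma two_rots_not_MDTS: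
  assumes ij: "\<not> 2 * int n dvd i - j" and s: "\<not> 2 * int n dvd i + j"
  shows "\<not> MDTS (Dic n) (dic_set {i, j} {k})"
proof (cases "2 * int n dvd i + j - int n")
  case True
  then have "2 * int n dvd i + j - int n + 2 * int n * 1" by (rule dvd_add) simp
  then have "2 * int n dvd (i + int n) + j" "2 * int n dvd (j + int n) + i"
    by (simp_all add: algebra_simps)
  then have "(i + int n) mod (2 * int n) = - j mod (2 * int n)"
    "(j + int n) mod (2 * int n) = - i mod (2 * int n)"
    by (simp_all add: mod_eq_dvd_iff)
  then have "rcard {i, j, i + int n, j + int n} = rcard {i, j, - i, - j}"
    by (simp add: rcard_def insert_commute)
  then show ?thesis
    unfolding MDTS_def two_rots_card_product two_rots_card_quotient by simp
next
  case False
  have "\<not> int n dvd i \<or> \<not> int n dvd j"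
  proof (rule ccontr)
    \<comment> \<open>The quotients of \<open>i - j\<close> and of \<open>i + j - n\<close> by \<open>n\<close> would both be odd, but they have opposite parities.\<close>
    assume "\<not> (\<not> int n dvd i \<or> \<not> int n dvd j)"
    then obtain x y where "i = int n * x" "j = int n * y" by (auto simp: dvd_def)
    then have "i - j = int n * (x - y)" "i + j - int n = int n * (x + y - 1)"
      by (simp_all add: algebra_simps)
    then have "odd (x - y)" "odd (x + y - 1)"
      using ij False n_pos by (auto simp: mult.commute[of 2])
    then show False by simp
  qed
  moreover have "rcard {i, j, - i, - j} \<ge> 3" if "\<not> int n dvd j"
    using two_rots_flips(1)[of j i] that ij s
    by (simp add: insert_commute add.commute dvd_diff_commute)
  ultimately have "rcard {i, j, - i, - j} \<ge> 3"
    using two_rots_flips(1)[of i j] ij s by blast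
  with False show ?thesis
    unfolding MDTS_def two_rots_card_product two_rots_card_quotient
    using rcard_quotient_flips_le[of i j] by simp
qed

text \<open>The coincidences among \<open>k + i, k + j, i - k, j - k\<close> with \<open>i \<noteq> j\<close> are \<open>2k = 0\<close> and
  \<open>2k = \<plusminus> (i - j)\<close>.\<close>

lemma two_flips_flips:
  assumes "\<not> 2 * int n dvd i - j" "\<not> int n dvd k" "\<not> 2 * int n dvd 2 * k - (i - j)"
  shows "rcard {k + i, k + j, i - k, j - k} \<ge> 3"
    and "\<not> 2 * int n dvd 2 * k - (j - i) \<Longrightarrow> rcard {k + i, k + j, i - k, j - k} = 4"
proof -
  have *: "\<not> 2 * int n dvd j - i" "\<not> 2 * int n dvd k + j - (i - k)"
    "\<not> 2 * int n dvd (k + i) - (i - k)" "\<not> 2 * int n dvd (k + j) - (j - k)"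
    using assms by (simp_all add: dvd_diff_commute[of _ j] algebra_simps)
  have "3 = rcard {k + i, k + j, i - k}"
    using assms(1) * by (simp add: rcard_insert rcard_empty)
  also have "rcard {k + i, k + j, i - k} \<le> rcard {k + i, k + j, i - k, j - k}"
    by (rule rcard_mono) auto
  finally show "rcard {k + i, k + j, i - k, j - k} \<ge> 3" .
  show "rcard {k + i, k + j, i - k, j - k} = 4" if "\<not> 2 * int n dvd 2 * k - (j - i)"
  proof -
    have "\<not> 2 * int n dvd k + i - (j - k)" using that by (simp add: algebra_simps)
    then show ?thesis
      using assms(1) * by (simp add: rcard_insert rcard_empty)
  qed
qed

lemma two_flips_MSTD:
  assumes "\<not> 2 * int n dvd i - j" "\<not> int n dvd k"
    "\<not> 2 * int n dvd 2 * k - (i - j)" "\<not> 2 * int n dvd 2 * k - (j - i)"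
    "\<not> 2 * int n dvd 2 * k - (i - j) - int n" "\<not> 2 * int n dvd 2 * k - (j - i) - int n"
  shows "MSTD (Dic n) (dic_set {k} {i, j})"
  unfolding MSTD_def two_flips_card_product two_flips_card_quotient
  using two_flips_flips(2)[of i j k] rcard_quotient_flips_le[of i j] assms by simp

text \<open>If \<open>2k\<close> is not \<open>0\<close> then at most one pair among the four flips of \<open>A + A\<close> coincides, since
  two coincidences would give \<open>4k = 0\<close>. The extra rotation \<open>a\<^sup>2\<^sup>k\<close> is lost only if
  \<open>2k = n \<plusminus> (i - j)\<close>, and then a coincidence \<open>2k = \<plusminus> (i - j)\<close> would give \<open>n = 0\<close> or \<open>4k = n\<close>
  modulo \<open>2n\<close>. So at most one of the five elements is lost.\<close>

lemma two_flips_not_MDTS: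
  assumes ij: "\<not> 2 * int n dvd i - j" and k: "\<not> int n dvd k"
  shows "\<not> MDTS (Dic n) (dic_set {k} {i, j})"
proof -
  let ?F = "{k + i, k + j, i - k, j - k}"
  have full: "rcard {k + x, k + y, x - k, y - k} = 4"
    if xy: "\<not> 2 * int n dvd x - y" and dv: "2 * int n dvd 2 * k - (x - y) - int n" for x y
  proof -
    have "\<not> 2 * int n dvd 2 * k - (x - y)"
    proof
      assume "2 * int n dvd 2 * k - (x - y)"
      from dvd_diff[OF this dv] show False using double_not_cong_n[of 0] by simp
    qed
    moreover have "\<not> 2 * int n dvd 2 * k - (y - x)"
    proof
      assume "2 * int n dvd 2 * k - (y - x)"
      from dvd_add[OF dv this] show False
        using double_not_cong_n(1)[of "2 * k"] by (simp add: algebra_simps)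
    qed
    ultimately show ?thesis using two_flips_flips(2)[of x y k] xy k by simp
  qed
  have ge3: "rcard ?F \<ge> 3"
  proof -
    have "\<not> (2 * int n dvd 2 * k - (i - j) \<and> 2 * int n dvd 2 * k - (j - i))"
    proof
      assume "2 * int n dvd 2 * k - (i - j) \<and> 2 * int n dvd 2 * k - (j - i)"
      then have "2 * int n dvd (2 * k - (i - j)) + (2 * k - (j - i))" by (intro dvd_add) auto
      then have "2 * int n dvd 2 * (2 * k)" by (simp add: algebra_simps)
      then have "int n dvd 2 * k" unfolding dvd_mult_cancel_left by simp
      with k odd_n show False by (simp add: coprime_dvd_mult_right_iff)
    qed
    moreover have "rcard {k + j, k + i, j - k, i - k} = rcard ?F"
      by (simp add: insert_commute)
    ultimately show ?thesis
      using two_flips_flips(1)[of i j k] two_flips_flips(1)[of j i k] ij k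
      by (auto simp: dvd_diff_commute)
  qed
  have "4 \<le> (if 2 * int n dvd 2 * k - (i - j) - int n \<or> 2 * int n dvd 2 * k - (j - i) - int n then 0 else 1)
      + rcard ?F"
    using full[of i j] full[of j i] ge3 ij
    by (auto simp: dvd_diff_commute insert_commute)
  then show ?thesis
    unfolding MDTS_def two_flips_card_product two_flips_card_quotient
    using rcard_quotient_flips_le[of i j] by linarith
qed

text \<open>For flips alone, sums are the differences translated by \<open>n\<close>.\<close>

lemma three_flips_not_MDTS:
  assumes "finite J"
  shows "\<not> MDTS (Dic n) (dic_set {} J)"
proof -
  have "(\<Union>i\<in>J. \<Union>j\<in>J. {i - j + int n}) = (+) (int n) ` (\<Union>i\<in>J. \<Union>j\<in>J. {i - j})"
    by (auto simp: image_UN)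
  then show ?thesis
    using assms
    by (simp add: MDTS_def dic_set_mult dic_set_quotient card_dic_set rcard_empty rcard_translate)
qed

section \<open>Counting\<close>

abbreviation pairs :: "int set set" where
  "pairs \<equiv> {I. I \<subseteq> exps \<and> card I = 2}"

lemma finite_pairs: "finite pairs"
  by (rule finite_subset[of _ "Pow exps"]) auto

lemma card_subsets_exps: "card {I. I \<subseteq> exps \<and> card I = r} = 2 * n choose r"
  by (simp only: n_subsets[OF finite_atLeastLessThan_int] card_exps)

lemma card_pairs: "card pairs = n * (2 * n - 1)"
  by (simp add: card_subsets_exps choose_two)

lemma pairsE:
  assumes "I \<in> pairs"
  obtains i j where "I = {i, j}" "i \<in> exps" "j \<in> exps" "i < j" "\<not> 2 * int n dvd i - j"
proof -
  from assms obtain x y where xy: "I = {x, y}" "x \<noteq> y" "x \<in> exps" "y \<in> exps"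
    by (auto simp: card_2_iff)
  define i j where "i = min x y" and "j = max x y"
  have ij: "I = {i, j}" "i \<in> exps" "j \<in> exps" "i < j"
    using xy by (auto simp: i_def j_def min_def max_def)
  then have "i mod (2 * int n) \<noteq> j mod (2 * int n)" by simp
  then have "\<not> 2 * int n dvd i - j" by (simp add: mod_eq_dvd_iff)
  with ij show thesis by (rule that)
qed

lemma cong_expsD:
  assumes "j \<in> exps" "2 * int n dvd j - x"
  shows "j = x mod (2 * int n)"
  using assms by (simp flip: mod_eq_dvd_iff)

lemma n_dvd_exps:
  assumes "i \<in> exps" "int n dvd i"
  shows "i = 0 \<or> i = int n"
proof -
  obtain q where q: "i = int n * q" using assms(2) by (rule dvdE)
  then have "0 \<le> q" "q < 2"
    using assms(1) n_pos by (auto simp: zero_le_mult_iff mult.commute[of 2])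
  then have "q = 0 \<or> q = 1" by auto
  with q show ?thesis by auto
qed

text \<open>The pairs \<open>{i, -i}\<close> of distinct residues modulo \<open>2n\<close>, written with representatives.\<close>

definition opposite_pairs :: "int set set" where
  "opposite_pairs = (\<lambda>x. {x, 2 * int n - x}) ` {1..<int n}"

lemma opposite_pairsI:
  assumes "i \<in> exps" "j \<in> exps" "i < j" "2 * int n dvd i + j"
  shows "{i, j} \<in> opposite_pairs"
proof -
  obtain q where q: "i + j = 2 * int n * q" using assms(4) by (rule dvdE)
  have "0 < 2 * int n * q" "2 * int n * q < 2 * int n * 2"
    using assms(1-3) by (simp_all flip: q)
  then have "0 < q" "q < 2" by (simp_all add: zero_less_mult_iff)
  then have "q = 1" by simp
  then have "j = 2 * int n - i" using q by simp
  with assms(1-3) show ?thesis by (auto simp: opposite_pairs_def intro!: rev_image_eqI[of i])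
qed

lemma card_opposite_pairs: "card opposite_pairs \<le> n - 1"
proof -
  have "card opposite_pairs \<le> card {1..<int n}"
    unfolding opposite_pairs_def by (rule card_image_le) simp
  then show ?thesis by simp
qed

text \<open>A superset of the exceptions in \<open>two_rots_MSTD\<close>: the pairs containing \<open>0\<close> or \<open>n\<close>, and
  those with sum \<open>0\<close> or \<open>n\<close> modulo \<open>2n\<close>. Pairs with sum \<open>n\<close> are counted twice, which the final
  estimate can afford.\<close>

definition unbalanced_pairs :: "int set set" where
  "unbalanced_pairs = (\<lambda>x. {0, x}) ` exps \<union> (\<lambda>x. {int n, x}) ` exps \<union> opposite_pairs
     \<union> (\<lambda>x. {x, (int n - x) mod (2 * int n)}) ` exps"

lemma card_image_exps: "card (f ` exps) \<le> 2 * n"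
  using card_image_le[of exps f] by simp

lemma card_unbalanced_pairs: "card unbalanced_pairs \<le> 7 * n - 1"
proof -
  have "card unbalanced_pairs \<le> 2 * n + 2 * n + (n - 1) + 2 * n"
    unfolding unbalanced_pairs_def
    by (intro order.trans[OF card_Un_le] add_mono card_image_exps card_opposite_pairs)
  then show ?thesis using n_pos by simp
qed

lemma two_rots_MSTD_unless_unbalanced:
  assumes "I \<in> pairs" "I \<notin> unbalanced_pairs"
  shows "MSTD (Dic n) (dic_set I {k})"
proof -
  obtain i j where I: "I = {i, j}" "i \<in> exps" "j \<in> exps" "i < j" "\<not> 2 * int n dvd i - j"
    using assms(1) by (rule pairsE)
  have "i \<noteq> 0" "i \<noteq> int n" "j \<noteq> 0" "j \<noteq> int n"
    using assms(2) I(1-3) by (auto simp: unbalanced_pairs_def doubleton_eq_iff)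
  then have "\<not> int n dvd i" "\<not> int n dvd j"
    using I(2,3) n_dvd_exps[of i] n_dvd_exps[of j] by blast+
  moreover have "\<not> 2 * int n dvd i + j"
    using opposite_pairsI[OF I(2-4)] assms(2) I(1) by (auto simp: unbalanced_pairs_def)
  moreover have "\<not> 2 * int n dvd i + j - int n"
  proof
    assume "2 * int n dvd i + j - int n"
    then have "j = (int n - i) mod (2 * int n)"
      using I(3) by (intro cong_expsD) (simp_all add: algebra_simps)
    then show False using assms(2) I(1,2) by (auto simp: unbalanced_pairs_def)
  qed
  ultimately show ?thesis unfolding I(1) using I(5) by (intro two_rots_MSTD)
qed

lemma two_rots_MDTS_imp_opposite:
  assumes "I \<in> pairs" "MDTS (Dic n) (dic_set I {k})"
  shows "I \<in> opposite_pairs"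
proof -
  obtain i j where I: "I = {i, j}" "i \<in> exps" "j \<in> exps" "i < j" "\<not> 2 * int n dvd i - j"
    using assms(1) by (rule pairsE)
  then show ?thesis using two_rots_not_MDTS[of i j k] opposite_pairsI[of i j] assms(2) by blast
qed

text \<open>The exceptions in \<open>two_flips_MSTD\<close> for a given rotation \<open>a\<^sup>k\<close>: the pairs whose difference
  is, up to sign, \<open>2k\<close> or \<open>2k - n\<close> modulo \<open>2n\<close>.\<close>

definition resonant_pairs :: "int \<Rightarrow> int set set" where
  "resonant_pairs k = (\<lambda>x. {x, (x + 2 * k) mod (2 * int n)}) ` exps
     \<union> (\<lambda>x. {x, (x + 2 * k - int n) mod (2 * int n)}) ` exps"

lemma card_resonant_pairs: "card (resonant_pairs k) \<le> 4 * n"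
proof -
  have "card (resonant_pairs k) \<le> 2 * n + 2 * n"
    unfolding resonant_pairs_def
    by (intro order.trans[OF card_Un_le] add_mono card_image_exps)
  then show ?thesis by simp
qed

lemma two_flips_MSTD_unless_resonant:
  assumes "k \<in> exps - {0, int n}" "J \<in> pairs" "J \<notin> resonant_pairs k"
  shows "MSTD (Dic n) (dic_set {k} J)"
proof -
  obtain i j where J: "J = {i, j}" "i \<in> exps" "j \<in> exps" "i < j" "\<not> 2 * int n dvd i - j"
    using assms(2) by (rule pairsE)
  have r: "\<not> 2 * int n dvd 2 * k - (x - y)" "\<not> 2 * int n dvd 2 * k - (x - y) - int n"
    if "J = {y, x}" "x \<in> exps" "y \<in> exps" for x y
  proof -
    have "x \<noteq> (y + 2 * k) mod (2 * int n)" "x \<noteq> (y + 2 * k - int n) mod (2 * int n)"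
      using assms(3) that by (auto simp: resonant_pairs_def)
    then have "\<not> 2 * int n dvd x - (y + 2 * k)" "\<not> 2 * int n dvd x - (y + 2 * k - int n)"
      using cong_expsD[OF that(2)] by blast+
    moreover have "2 * k - (x - y) = (y + 2 * k) - x"
      "2 * k - (x - y) - int n = (y + 2 * k - int n) - x" by simp_all
    ultimately show "\<not> 2 * int n dvd 2 * k - (x - y)" "\<not> 2 * int n dvd 2 * k - (x - y) - int n"
      by (simp_all only: dvd_diff_commute[of _ x] not_False_eq_True)
  qed
  have "\<not> int n dvd k" using assms(1) n_dvd_exps by auto
  then show ?thesis
    unfolding J(1) using J(5) r[of j i] r[of i j] J(1-3)
    by (intro two_flips_MSTD) (auto simp: insert_commute)
qed

lemma two_flips_MDTS_imp_central:
  assumes "J \<in> pairs" "k \<in> exps" "MDTS (Dic n) (dic_set {k} J)"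
  shows "k \<in> {0, int n}"
proof -
  obtain i j where J: "J = {i, j}" "i \<in> exps" "j \<in> exps" "i < j" "\<not> 2 * int n dvd i - j"
    using assms(1) by (rule pairsE)
  then show ?thesis using two_flips_not_MDTS[of i j k] n_dvd_exps[of k] assms(2,3) by blast
qed

lemma finite_triples: "finite (subsets_of_size (Dic n) 3)"
  by (rule finite_subset[of _ "Pow (carrier (Dic n))"])
    (auto simp: subsets_of_size_def Dic_carrier_eq)

text \<open>The first summand comes from two rotations and an arbitrary flip, the second from two
  flips and a rotation outside \<open>{1, a\<^sup>n}\<close>.\<close>

lemma card_MSTD_ge:
  "int (card {A \<in> subsets_of_size (Dic n) 3. MSTD (Dic n) A})
    \<ge> (int n * (2 * int n - 1) - (7 * int n - 1)) * (2 * int n)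
      + (2 * int n - 2) * (int n * (2 * int n - 1) - 4 * int n)"
proof -
  define S where "S = (\<lambda>(I, k). (I, {k})) ` ((pairs - unbalanced_pairs) \<times> exps)"
  define T where "T = (\<lambda>(k, J). ({k}, J)) ` (SIGMA k:exps - {0, int n}. pairs - resonant_pairs k)"
  have fin: "finite S" "finite T" using finite_pairs by (auto simp: S_def T_def)
  have P: "int (card pairs) = int n * (2 * int n - 1)"
    using n_pos by (simp add: card_pairs)
  have "card pairs - card unbalanced_pairs \<le> card (pairs - unbalanced_pairs)"
    using finite_pairs by (intro diff_card_le_card_Diff) (simp add: unbalanced_pairs_def opposite_pairs_def)
  then have "int (card (pairs - unbalanced_pairs)) \<ge> int (card pairs) - (7 * int n - 1)"
    using card_unbalanced_pairs n_pos by linarith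
  moreover have "card S = card (pairs - unbalanced_pairs) * (2 * n)"
    unfolding S_def by (subst card_image) (auto simp: inj_on_def card_cartesian_product)
  ultimately have S: "int (card S) \<ge> (int n * (2 * int n - 1) - (7 * int n - 1)) * (2 * int n)"
    by (simp add: mult_right_mono P)
  have r: "int (card (pairs - resonant_pairs k)) \<ge> int n * (2 * int n - 1) - 4 * int n" for k
  proof -
    have "card pairs - card (resonant_pairs k) \<le> card (pairs - resonant_pairs k)"
      by (intro diff_card_le_card_Diff) (simp add: resonant_pairs_def)
    then show ?thesis using card_resonant_pairs[of k] P by linarith
  qed
  have "card T = (\<Sum>k\<in>exps - {0, int n}. card (pairs - resonant_pairs k))"
    unfolding T_def using finite_pairs by (subst card_image) (auto simp: inj_on_def)
  then have "int (card T) = (\<Sum>k\<in>exps - {0, int n}. int (card (pairs - resonant_pairs k)))"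
    by simp
  also have "\<dots> \<ge> (\<Sum>k\<in>exps - {0, int n}. int n * (2 * int n - 1) - 4 * int n)"
    using r by (rule sum_mono)
  also have "card (exps - {0, int n}) = 2 * n - 2"
    using n_pos by (subst card_Diff_subset) auto
  then have "(\<Sum>k\<in>exps - {0, int n}. int n * (2 * int n - 1) - 4 * int n)
      = (2 * int n - 2) * (int n * (2 * int n - 1) - 4 * int n)"
    using n_pos by simp
  finally have T: "int (card T) \<ge> (2 * int n - 2) * (int n * (2 * int n - 1) - 4 * int n)" .
  have "S \<inter> T = {}" by (auto simp: S_def T_def)
  then have "card (S \<union> T) = card S + card T" using fin by (intro card_Un_disjoint)
  moreover have "S \<union> T \<subseteq> Pow exps \<times> Pow exps" by (auto simp: S_def T_def)
  then have "card ((\<lambda>(I, J). dic_set I J) ` (S \<union> T)) = card (S \<union> T)"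
    by (intro card_image inj_on_subset[OF inj_on_dic_set])
  moreover have "(\<lambda>(I, J). dic_set I J) ` (S \<union> T) \<subseteq> {A \<in> subsets_of_size (Dic n) 3. MSTD (Dic n) A}"
    using two_rots_MSTD_unless_unbalanced two_flips_MSTD_unless_resonant
    by (auto simp: S_def T_def subsets_of_size_def card_dic_set_exps dic_set_subset[THEN subsetD])
  then have "card ((\<lambda>(I, J). dic_set I J) ` (S \<union> T))
      \<le> card {A \<in> subsets_of_size (Dic n) 3. MSTD (Dic n) A}"
    using finite_triples by (intro card_mono) auto
  ultimately show ?thesis using S T by linarith
qed

text \<open>The sets of three rotations all count as MDTS here, which is the truth for generic ones:
  in an abelian group three elements have up to six sums, but up to seven differences. The
  second summand bounds the sets \<open>{a\<^sup>i, a\<^sup>-\<^sup>i, a\<^sup>kb}\<close>, the third the sets of two flips and one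
  of \<open>1, a\<^sup>n\<close>.\<close>

lemma card_MDTS_le:
  "card {A \<in> subsets_of_size (Dic n) 3. MDTS (Dic n) A}
    \<le> (2 * n choose 3) + (n - 1) * (2 * n) + 2 * (n * (2 * n - 1))"
proof -
  define R where "R = (\<lambda>I. dic_set I {}) ` {I. I \<subseteq> exps \<and> card I = 3}"
  define S where "S = (\<lambda>(I, k). dic_set I {k}) ` (opposite_pairs \<times> exps)"
  define T where "T = (\<lambda>(k, J). dic_set {k} J) ` ({0, int n} \<times> pairs)"
  have fin: "finite {I. I \<subseteq> exps \<and> card I = 3}" "finite opposite_pairs"
    by (rule finite_subset[of _ "Pow exps"]) (auto simp: opposite_pairs_def)
  have "{A \<in> subsets_of_size (Dic n) 3. MDTS (Dic n) A} \<subseteq> R \<union> S \<union> T"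
  proof
    fix A assume A: "A \<in> {A \<in> subsets_of_size (Dic n) 3. MDTS (Dic n) A}"
    then have "A \<subseteq> carrier (Dic n)" by (simp add: subsets_of_size_def)
    then obtain I J where IJ: "I \<subseteq> exps" "J \<subseteq> exps" "A = dic_set I J" by (rule dic_set_cases)
    then have fIJ: "finite I" "finite J" by (auto intro: finite_subset)
    have "card I + card J = 3" using A IJ by (simp add: subsets_of_size_def card_dic_set_exps)
    then consider "card I = 3" "card J = 0" | "card I = 2" "card J = 1"
      | "card I = 1" "card J = 2" | "card I = 0" "card J = 3" by linarith
    then show "A \<in> R \<union> S \<union> T"
    proof cases
      case 1
      then show ?thesis using IJ fIJ by (auto simp: R_def)
    next
      case 2
      then obtain k where "J = {k}" by (metis card_1_singletonE)
      then show ?thesis using 2 IJ A two_rots_MDTS_imp_opposite[of I k] by (auto simp: S_def)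
    next
      case 3
      then obtain k where "I = {k}" by (metis card_1_singletonE)
      then show ?thesis using 3 IJ A two_flips_MDTS_imp_central[of J k] by (auto simp: T_def)
    next
      case 4
      then show ?thesis using IJ fIJ A three_flips_not_MDTS[of J] by auto
    qed
  qed
  moreover have "finite R" "finite S" "finite T"
    using fin finite_pairs by (auto simp: R_def S_def T_def)
  ultimately have "card {A \<in> subsets_of_size (Dic n) 3. MDTS (Dic n) A} \<le> card (R \<union> S \<union> T)"
    by (intro card_mono) auto
  also have "\<dots> \<le> card R + card S + card T"
    by (intro order.trans[OF card_Un_le] add_mono card_Un_le order_refl)
  also have "card R \<le> 2 * n choose 3"
    unfolding R_def card_subsets_exps[symmetric] by (rule card_image_le[OF fin(1)])
  also have "card S \<le> card (opposite_pairs \<times> exps)"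
    unfolding S_def using fin by (intro card_image_le) auto
  also have "\<dots> \<le> (n - 1) * (2 * n)"
    unfolding card_cartesian_product card_exps by (intro mult_le_mono1 card_opposite_pairs)
  also have "card T \<le> card ({0, int n} \<times> pairs)"
    unfolding T_def using finite_pairs by (intro card_image_le) auto
  also have "\<dots> = 2 * (n * (2 * n - 1))"
    using n_pos by (simp add: card_cartesian_product card_pairs)
  finally show ?thesis by simp
qed

end

lemma six_choose_three: "6 * int (m choose 3) = int m * (int m - 1) * (int m - 2)"
proof -
  have *: "6 * (Suc (Suc k) choose 3) = Suc (Suc k) * (Suc k * k)" for k
  proof -
    have "3 * (Suc (Suc k) choose 3) = Suc (Suc k) * (Suc k choose 2)"
      using Suc_times_binomial[of 2 "Suc k"] by (simp only: eval_nat_numeral)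
    moreover have "2 * (Suc k choose 2) = Suc k * k"
      using Suc_times_binomial[of 1 k] by (simp add: numeral_2_eq_2)
    moreover have "6 * (Suc (Suc k) choose 3) = 2 * (3 * (Suc (Suc k) choose 3))" by simp
    ultimately show ?thesis by (simp only: mult.left_commute)
  qed
  show ?thesis
  proof (cases "m < 2")
    case True
    then have "m = 0 \<or> m = 1" by auto
    then show ?thesis by auto
  next
    case False
    then obtain k where "m = Suc (Suc k)" by (metis Suc_diff_Suc add_2_eq_Suc le_Suc_ex not_less)
    then show ?thesis using arg_cong[OF *[of k], of int] by (simp add: algebra_simps)
  qed
qed

theorem corollary1p1:
  fixes n :: nat
  assumes "n \<ge> 3" and "odd n" and "n \<noteq> 3"
  shows "card {A \<in> subsets_of_size (Dic n) 3. MSTD (Dic n) A}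
       > card {A \<in> subsets_of_size (Dic n) 3. MDTS (Dic n) A}"
proof -
  interpret odd_dicyclic n using assms by unfold_locales auto
  have "n \<noteq> 4" using assms(2) by auto
  with assms have "5 \<le> n" by linarith
  then obtain t where n: "n = t + 5" by (metis add.commute le_iff_add)
  let ?M = "int (card {A \<in> subsets_of_size (Dic n) 3. MSTD (Dic n) A})"
  let ?D = "int (card {A \<in> subsets_of_size (Dic n) 3. MDTS (Dic n) A})"
  have "?D \<le> int ((2 * n choose 3) + (n - 1) * (2 * n) + 2 * (n * (2 * n - 1)))"
    using card_MDTS_le by (simp only: of_nat_le_iff)
  also have "\<dots> = int (2 * n choose 3) + (int n - 1) * (2 * int n) + 2 * (int n * (2 * int n - 1))"
    using n by simp
  finally have D: "6 * ?D \<le> 6 * int (2 * n choose 3)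
      + 6 * ((int n - 1) * (2 * int n) + 2 * (int n * (2 * int n - 1)))" by simp
  have "0 < 4 * int n * (10 * int n * (int n - 5) - int n + 23)"
    unfolding n by (simp add: algebra_simps add_pos_nonneg)
  also have "\<dots> = 6 * ((int n * (2 * int n - 1) - (7 * int n - 1)) * (2 * int n)
      + (2 * int n - 2) * (int n * (2 * int n - 1) - 4 * int n))
    - (2 * int n * (2 * int n - 1) * (2 * int n - 2)
      + 6 * ((int n - 1) * (2 * int n) + 2 * (int n * (2 * int n - 1))))"
    by (simp add: algebra_simps)
  also have "\<dots> \<le> 6 * ?M - 6 * ?D"
    using D card_MSTD_ge six_choose_three[of "2 * n"] by simp
  finally show ?thesis by simp
qed

end
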